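(* For every partition $\mu\vdash n$ and every integer $p$ with $2\le p\le\min\{\ell(\mu),\tfrac{1+\mu_1}{2}\}$, we have $(n-p,p)\in\Phi(\mu)$.
   Context: $\ell(\mu)$ is the number of parts of $\mu$ and $\mu_1$ its largest part. For $\mu\vdash n$, $\Phi(\mu)$ is the set of $\lambda\vdash n$ with $g(\lambda,\mu,\mu)=\langle\chi^\lambda,\chi^\mu\otimes\chi^\mu\rangle>0$, where $\chi^\lambda$ are the irreducible characters of $S_n$ and $\otimes$ is the pointwise product of characters. *)

theory Defs
  imports Complex_Main "HOL-Combinatorics.Permutations"
    "HOL-Library.Function_Algebras" "HOL-Library.Complex_Order"
begin

text \<open>A partition is the list of its parts in weakly decreasing order, so the number of parts
  of \<open>mu\<close> is \<open>length mu\<close>.\<close>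

definition is_partition :: "nat list \<Rightarrow> nat \<Rightarrow> bool"  (infix \<open>\<turnstile>\<close> 50)
  where "mu \<turnstile> n \<longleftrightarrow> sorted_wrt (\<ge>) mu \<and> (\<forall>k\<in>set mu. 0 < k) \<and> sum_list mu = n"

definition largest_part :: "nat list \<Rightarrow> nat"
  where "largest_part mu = (if mu = [] then 0 else hd mu)"


definition fscale :: "complex \<Rightarrow> ('a \<Rightarrow> complex) \<Rightarrow> 'a \<Rightarrow> complex"
  where "fscale c f = (\<lambda>x. c * f x)"

global_interpretation fvs: vector_space "fscale :: complex \<Rightarrow> ('a \<Rightarrow> complex) \<Rightarrow> 'a \<Rightarrow> complex"
  by unfold_locales (auto simp: fscale_def fun_eq_iff algebra_simps)

text \<open>Only meaningful for a finite-dimensional subspace \<open>V\<close> that \<open>F\<close> maps linearly to itself;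
  the value is then independent of the chosen basis.\<close>

definition trace_on :: "('a \<Rightarrow> complex) set \<Rightarrow> (('a \<Rightarrow> complex) \<Rightarrow> 'a \<Rightarrow> complex) \<Rightarrow> complex"
  where "trace_on V F =
    (let B = (SOME B. fvs.independent B \<and> fvs.span B = V)
     in \<Sum>b\<in>B. fvs.representation B (F b) b)"


text \<open>\<open>S\<^sub>n\<close> is the set of permutations of \<open>{..<n}\<close>. A tableau of shape
  \<open>lam\<close> assigns to each cell (row, column) its entry; values outside the diagram are irrelevant.
  A tabloid is the list of the sets of row entries.\<close>

definition cells :: "nat list \<Rightarrow> (nat \<times> nat) set"
  where "cells lam = {(i, j). i < length lam \<and> j < lam ! i}"

definition tableaux :: "nat list \<Rightarrow> (nat \<times> nat \<Rightarrow> nat) set"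
  where "tableaux lam = {t. bij_betw t (cells lam) {..<sum_list lam}}"

definition tabloid :: "nat list \<Rightarrow> (nat \<times> nat \<Rightarrow> nat) \<Rightarrow> nat set list"
  where "tabloid lam t = map (\<lambda>i. {t (i, j) | j. j < lam ! i}) [0..<length lam]"

definition column :: "nat list \<Rightarrow> (nat \<times> nat \<Rightarrow> nat) \<Rightarrow> nat \<Rightarrow> nat set"
  where "column lam t j = {t (i, j) | i. (i, j) \<in> cells lam}"

definition column_stabilizer :: "nat list \<Rightarrow> (nat \<times> nat \<Rightarrow> nat) \<Rightarrow> (nat \<Rightarrow> nat) set"
  where "column_stabilizer lam t =
    {p. p permutes {..<sum_list lam} \<and> (\<forall>j. p ` column lam t j = column lam t j)}"

text \<open>Formal linear combinations of tabloids are coefficient functions. The polytabloid of \<open>t\<close>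
  is the sum of \<open>sgn p \<cdot> {p t}\<close> over the column stabilizer of \<open>t\<close>.\<close>

definition polytabloid :: "nat list \<Rightarrow> (nat \<times> nat \<Rightarrow> nat) \<Rightarrow> nat set list \<Rightarrow> complex"
  where "polytabloid lam t =
    (\<lambda>T. \<Sum>p\<in>column_stabilizer lam t. of_int (sign p) * (if tabloid lam (p \<circ> t) = T then 1 else 0))"

definition specht :: "nat list \<Rightarrow> (nat set list \<Rightarrow> complex) set"
  where "specht lam = fvs.span (polytabloid lam ` tableaux lam)"

text \<open>The linear extension of \<open>T \<mapsto> p T\<close>; on coefficient functions this is composition with the
  action of the inverse permutation.\<close>

definition perm_act :: "(nat \<Rightarrow> nat) \<Rightarrow> (nat set list \<Rightarrow> complex) \<Rightarrow> nat set list \<Rightarrow> complex"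
  where "perm_act p f = (\<lambda>T. f (map ((`) (inv p)) T))"

text \<open>The irreducible character \<open>\<chi>\<^sup>\<lambda>\<close> is the character of the Specht module;
  it is only used on permutations of \<open>{..<sum_list lam}\<close>.\<close>

definition irr_char :: "nat list \<Rightarrow> (nat \<Rightarrow> nat) \<Rightarrow> complex"
  where "irr_char lam p = trace_on (specht lam) (perm_act p)"


definition char_inner :: "nat \<Rightarrow> ((nat \<Rightarrow> nat) \<Rightarrow> complex) \<Rightarrow> ((nat \<Rightarrow> nat) \<Rightarrow> complex) \<Rightarrow> complex"
  where "char_inner n \<phi> \<psi> = (\<Sum>p | p permutes {..<n}. \<phi> p * cnj (\<psi> p)) / fact n"

definition kronecker :: "nat list \<Rightarrow> nat list \<Rightarrow> nat list \<Rightarrow> complex"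
  where "kronecker lam mu nu =
    char_inner (sum_list lam) (irr_char lam) (\<lambda>p. irr_char mu p * irr_char nu p)"

text \<open>\<open>0 < z\<close> for complex \<open>z\<close> means that \<open>z\<close> is real and positive.\<close>

definition Phi :: "nat list \<Rightarrow> nat list set"
  where "Phi mu = {lam. lam \<turnstile> sum_list mu \<and> 0 < kronecker lam mu mu}"

end

theory Submission
  imports Defs
begin

text \<open>For \<open>lam = (n - p, p)\<close>, a nonzero invariant form on \<open>S\<^bsup>lam\<^esup> \<times> S\<^bsup>mu\<^esup> \<times> S\<^bsup>mu\<^esup>\<close>, linear in the first
  argument and antilinear in the other two, forces \<open>g(lam, mu, mu) > 0\<close>. Let \<open>X\<^sub>A\<close> be the
  antisymmetrizer of a \<open>p\<close>-subset \<open>A\<close>; then \<open>A \<mapsto> X\<^sub>A\<close> is an equivariant map from tabloids of shape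
  \<open>lam\<close> to endomorphisms of \<open>S\<^bsup>mu\<^esup>\<close>, hence gives such a form. To see that it does not vanish, take a
  \<open>mu\<close>-tableau \<open>t\<close>, let \<open>a\<^sub>0, \<dots>, a\<^bsub>p-1\<^esub>\<close> be the top of its first column and \<open>b\<^sub>0, \<dots>, b\<^bsub>p-1\<^esub>\<close> the entries
  following \<open>a\<^sub>0\<close> in its first row. The \<open>lam\<close>-polytabloid with columns \<open>b\<^sub>j, a\<^sub>j\<close> acts on the polytabloid
  of \<open>t\<close> as an alternating sum of the \<open>X\<^sub>A\<close>, where \<open>A\<close> picks one of \<open>a\<^sub>j, b\<^sub>j\<close> for each \<open>j\<close>. At the
  tabloid of \<open>t\<close> every such \<open>A\<close> with two elements in the first row contributes \<open>0\<close>. Only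
  \<open>{a\<^sub>0, \<dots>, a\<^bsub>p-1\<^esub>}\<close> and \<open>{b\<^sub>0, a\<^sub>1, \<dots>, a\<^bsub>p-1\<^esub>}\<close> remain, with total \<open>p! - (p-1)! \<noteq> 0\<close>.\<close>

section \<open>Orthonormal bases and traces\<close>

lemma sum_fun_apply: "(\<Sum>i\<in>I. f i) x = (\<Sum>i\<in>I. f i x)"
  by (induction I rule: infinite_finite_induct) auto

definition fun_inner :: "'a set \<Rightarrow> ('a \<Rightarrow> complex) \<Rightarrow> ('a \<Rightarrow> complex) \<Rightarrow> complex"
  where "fun_inner X f g = (\<Sum>x\<in>X. f x * cnj (g x))"

lemma cnj_fun_inner: "cnj (fun_inner X f g) = fun_inner X g f"
  by (simp add: fun_inner_def mult.commute)

lemma fun_inner_sum_left: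
  "fun_inner X (\<lambda>x. \<Sum>i\<in>I. c i * f i x) g = (\<Sum>i\<in>I. c i * fun_inner X (f i) g)"
  unfolding fun_inner_def sum_distrib_left sum_distrib_right
  by (subst sum.swap) (simp add: mult.assoc)

lemma fun_inner_diff_left:
  "fun_inner X (\<lambda>x. f x - f' x) g = fun_inner X f g - fun_inner X f' g"
  by (simp add: fun_inner_def left_diff_distrib sum_subtractf)

lemma fun_inner_self: "fun_inner X f f = of_real (\<Sum>x\<in>X. (cmod (f x))\<^sup>2)"
  by (simp add: fun_inner_def complex_norm_square flip: of_real_power)

definition orthonormal_basis :: "'a set \<Rightarrow> ('a \<Rightarrow> complex) set \<Rightarrow> ('a \<Rightarrow> complex) set \<Rightarrow> bool"
  where "orthonormal_basis X V E \<longleftrightarrow> finite E \<and> E \<subseteq> V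
    \<and> (\<forall>d\<in>E. \<forall>e\<in>E. fun_inner X d e = of_bool (d = e))
    \<and> (\<forall>v\<in>V. \<forall>x. v x = (\<Sum>e\<in>E. fun_inner X v e * e x))"

lemma orthonormal_basisI:
  assumes "finite E" "E \<subseteq> V"
    and orth: "\<And>d e. d \<in> E \<Longrightarrow> e \<in> E \<Longrightarrow> fun_inner X d e = of_bool (d = e)"
    and expand: "\<And>v. v \<in> V \<Longrightarrow> \<exists>c. \<forall>x. v x = (\<Sum>e\<in>E. c e * e x)"
  shows "orthonormal_basis X V E"
  unfolding orthonormal_basis_def
proof (intro conjI ballI allI)
  fix v x assume "v \<in> V"
  then obtain c where c: "v = (\<lambda>x. \<Sum>e\<in>E. c e * e x)"
    using expand by blast
  have "fun_inner X v e = c e" if "e \<in> E" for e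
  proof -
    have "fun_inner X v e = (\<Sum>d\<in>E. c d * of_bool (d = e))"
      unfolding c fun_inner_sum_left using orth that by simp
    then show ?thesis
      using assms(1) that by simp
  qed
  then show "v x = (\<Sum>e\<in>E. fun_inner X v e * e x)"
    by (simp add: c)
qed (use assms in auto)

lemma gram_schmidt:
  assumes "finite B" "finite X" "\<And>b x. b \<in> B \<Longrightarrow> x \<notin> X \<Longrightarrow> b x = 0"
  shows "\<exists>E. orthonormal_basis X (fvs.span B) E"
  using assms(1,3)
proof (induction B)
  case empty
  have "orthonormal_basis X (fvs.span {}) {}"
    by (rule orthonormal_basisI) (auto simp: fvs.span_empty)
  then show ?case ..
next
  case (insert b B)
  then obtain E where E: "orthonormal_basis X (fvs.span B) E"
    by blast
  then have finE: "finite E" and EB: "E \<subseteq> fvs.span B"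
    and orth: "\<And>d e. d \<in> E \<Longrightarrow> e \<in> E \<Longrightarrow> fun_inner X d e = of_bool (d = e)"
    and expand: "\<And>v x. v \<in> fvs.span B \<Longrightarrow> v x = (\<Sum>e\<in>E. fun_inner X v e * e x)"
    unfolding orthonormal_basis_def by auto
  have EB': "E \<subseteq> fvs.span (insert b B)"
    using EB fvs.span_mono[of B "insert b B"] by blast
  define r where "r = (\<lambda>x. b x - (\<Sum>e\<in>E. fun_inner X b e * e x))"
  have split: "\<exists>k c. \<forall>x. v x = k * r x + (\<Sum>e\<in>E. c e * e x)" if v: "v \<in> fvs.span (insert b B)" for v
  proof -
    obtain k where k: "v - fscale k b \<in> fvs.span B"
      using v fvs.span_breakdown_eq by blast
    let ?u = "v - fscale k b"
    have "v x = k * r x + (\<Sum>e\<in>E. (k * fun_inner X b e + fun_inner X ?u e) * e x)" for x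
    proof -
      have "v x = k * b x + ?u x"
        by (simp add: fscale_def)
      also have "?u x = (\<Sum>e\<in>E. fun_inner X ?u e * e x)"
        by (rule expand[OF k])
      finally show ?thesis
        by (simp add: r_def algebra_simps sum.distrib sum_distrib_left)
    qed
    then show ?thesis
      by (intro exI[of _ k] exI[of _ "\<lambda>e. k * fun_inner X b e + fun_inner X ?u e"]) blast
  qed
  have r_perp: "fun_inner X r e = 0" if "e \<in> E" for e
  proof -
    have "(\<Sum>d\<in>E. fun_inner X b d * fun_inner X d e) = (\<Sum>d\<in>E. fun_inner X b d * of_bool (d = e))"
      using orth that by simp
    then show ?thesis
      unfolding r_def fun_inner_diff_left fun_inner_sum_left using finE that by simp
  qed
  show ?case
  proof (cases "r = 0")
    case True
    have "orthonormal_basis X (fvs.span (insert b B)) E"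
    proof (rule orthonormal_basisI)
      fix v assume "v \<in> fvs.span (insert b B)"
      then show "\<exists>c. \<forall>x. v x = (\<Sum>e\<in>E. c e * e x)"
        using split[of v] True by auto
    qed (use finE EB' orth in auto)
    then show ?thesis ..
  next
    case False
    then obtain x0 where x0: "r x0 \<noteq> 0"
      by (auto simp: fun_eq_iff)
    have supp: "v x = 0" if "v \<in> fvs.span (insert b B)" "x \<notin> X" for v x
      using that(1)
    proof (induction rule: fvs.span_induct_alt)
      case (step c w v)
      then show ?case using insert.prems[of w x] that(2) by (simp add: fscale_def)
    qed simp
    have r_span: "r \<in> fvs.span (insert b B)"
    proof -
      have "r = b - (\<Sum>e\<in>E. fscale (fun_inner X b e) e)"
        by (auto simp: r_def fun_eq_iff sum_fun_apply fscale_def)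
      also have "\<dots> \<in> fvs.span (insert b B)"
        using EB' by (intro fvs.span_diff fvs.span_sum fvs.span_scale) (auto intro: fvs.span_base)
      finally show ?thesis .
    qed
    then have "x0 \<in> X"
      using supp x0 by blast
    define s where "s = (\<Sum>x\<in>X. (cmod (r x))\<^sup>2)"
    have "s > 0"
      unfolding s_def using assms(2) \<open>x0 \<in> X\<close> x0 by (intro sum_pos2[of _ x0]) auto
    define k :: complex where "k = of_real (1 / sqrt s)"
    have k: "k \<noteq> 0" "k * cnj k * of_real s = 1"
      using \<open>s > 0\<close> by (auto simp: k_def simp flip: of_real_mult)
    define e0 where "e0 = fscale k r"
    have "fun_inner X e0 e = k * fun_inner X r e" for e
      by (simp add: fun_inner_def e0_def fscale_def sum_distrib_left mult.assoc)
    then have e0_perp: "fun_inner X e0 e = 0" if "e \<in> E" for e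
      using r_perp that by simp
    have "fun_inner X e0 e0 = k * cnj k * fun_inner X r r"
      by (simp add: fun_inner_def e0_def fscale_def sum_distrib_left mult_ac)
    then have e0_norm: "fun_inner X e0 e0 = 1"
      using k by (simp add: fun_inner_self s_def)
    have e0_notin: "e0 \<notin> E"
      using e0_perp e0_norm by auto
    have "orthonormal_basis X (fvs.span (insert b B)) (insert e0 E)"
    proof (rule orthonormal_basisI)
      show "insert e0 E \<subseteq> fvs.span (insert b B)"
        using EB' r_span by (auto simp: e0_def intro: fvs.span_scale)
    next
      fix d e assume "d \<in> insert e0 E" "e \<in> insert e0 E"
      then show "fun_inner X d e = of_bool (d = e)"
        using orth e0_perp e0_norm e0_notin cnj_fun_inner[of X e0 d] by auto
    next
      fix v assume "v \<in> fvs.span (insert b B)"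
      then obtain l c where lc: "\<And>x. v x = l * r x + (\<Sum>e\<in>E. c e * e x)"
        using split by blast
      have "v x = (\<Sum>e\<in>insert e0 E. (if e = e0 then l / k else c e) * e x)" for x
        using finE e0_notin k(1) lc[of x]
        by (auto simp: e0_def fscale_def intro!: sum.cong)
      then show "\<exists>c. \<forall>x. v x = (\<Sum>e\<in>insert e0 E. c e * e x)"
        by (intro exI[of _ "\<lambda>e. if e = e0 then l / k else c e"]) blast
    qed (use finE in auto)
    then show ?thesis ..
  qed
qed

lemma finite_of_independent_supported:
  assumes "finite X" "fvs.independent B" "\<And>b x. b \<in> B \<Longrightarrow> x \<notin> X \<Longrightarrow> b x = 0"
  shows "finite B"
proof -
  define \<delta> :: "'a \<Rightarrow> 'a \<Rightarrow> complex" where "\<delta> = (\<lambda>y x. of_bool (x = y))"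
  have "B \<subseteq> fvs.span (\<delta> ` X)"
  proof
    fix b assume "b \<in> B"
    have "b x = (\<Sum>y\<in>X. b y * \<delta> y x)" for x
    proof -
      have "(\<Sum>y\<in>X. b y * \<delta> y x) = (\<Sum>y\<in>X. if y = x then b y else 0)"
        by (intro sum.cong) (auto simp: \<delta>_def)
      then show ?thesis
        using assms(1) assms(3)[OF \<open>b \<in> B\<close>, of x] by simp
    qed
    then have "b = (\<Sum>y\<in>X. fscale (b y) (\<delta> y))"
      unfolding fun_eq_iff sum_fun_apply fscale_def by blast
    also have "\<dots> \<in> fvs.span (\<delta> ` X)"
      by (intro fvs.span_sum fvs.span_scale fvs.span_base) auto
    finally show "b \<in> fvs.span (\<delta> ` X)" .
  qed
  then show ?thesis
    using fvs.independent_span_bound assms(1,2) by (metis finite_imageI)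
qed

lemma orthonormal_basis_exists:
  assumes "finite X" "fvs.subspace V" "\<And>v x. v \<in> V \<Longrightarrow> x \<notin> X \<Longrightarrow> v x = 0"
  obtains E where "orthonormal_basis X V E"
proof -
  obtain B where B: "B \<subseteq> V" "fvs.independent B" "V \<subseteq> fvs.span B"
    by (rule fvs.maximal_independent_subset)
  have "fvs.span B = V"
    using fvs.span_minimal[OF B(1) assms(2)] B(3) by (rule subset_antisym)
  have supp: "b x = 0" if "b \<in> B" "x \<notin> X" for b x
    using assms(3) B(1) that by blast
  have "finite B"
    using finite_of_independent_supported[OF assms(1) B(2)] supp by blast
  then obtain E where "orthonormal_basis X (fvs.span B) E"
    using gram_schmidt[OF _ assms(1), of B] supp by blast
  then show thesis
    using that \<open>fvs.span B = V\<close> by simp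
qed

lemma trace_on_orthonormal_basis:
  assumes X: "finite X" and V: "fvs.subspace V" and supp: "\<And>v x. v \<in> V \<Longrightarrow> x \<notin> X \<Longrightarrow> v x = 0"
    and E: "orthonormal_basis X V E"
    and F_sum: "\<And>c. F (\<lambda>x. \<Sum>e\<in>E. c e * e x) = (\<lambda>x. \<Sum>e\<in>E. c e * F e x)"
    and F_closed: "\<And>v. v \<in> V \<Longrightarrow> F v \<in> V"
  shows "trace_on V F = (\<Sum>e\<in>E. fun_inner X (F e) e)"
proof -
  define B where "B = (SOME B. fvs.independent B \<and> fvs.span B = V)"
  have "\<exists>B. fvs.independent B \<and> fvs.span B = V"
    using fvs.basis_exists[of V] V fvs.span_minimal by (metis subset_antisym)
  then have B: "fvs.independent B" "fvs.span B = V"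
    unfolding B_def by (metis (mono_tags, lifting) someI_ex)+
  have BV: "B \<subseteq> V"
    using B(2) fvs.span_superset by blast
  have finB: "finite B"
    using finite_of_independent_supported[OF X B(1)] supp BV by blast
  have EV: "E \<subseteq> V" and expand: "\<And>v x. v \<in> V \<Longrightarrow> v x = (\<Sum>e\<in>E. fun_inner X v e * e x)"
    using E unfolding orthonormal_basis_def by auto
  let ?rep = "fvs.representation B"
  have rep: "?rep (F b) b = (\<Sum>e\<in>E. fun_inner X b e * ?rep (F e) b)" if "b \<in> B" for b
  proof -
    have "b \<in> V"
      using that BV by blast
    have "F b = F (\<lambda>x. \<Sum>e\<in>E. fun_inner X b e * e x)"
      using expand[OF \<open>b \<in> V\<close>] by (metis (no_types, lifting) ext)
    also have "\<dots> = (\<Sum>e\<in>E. fscale (fun_inner X b e) (F e))"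
      unfolding F_sum by (auto simp: fun_eq_iff sum_fun_apply fscale_def)
    finally have *: "F b = \<dots>" .
    show ?thesis
      unfolding * using B F_closed EV
      by (subst fvs.representation_sum)
        (auto simp: fvs.representation_scale fvs.subspace_scale[OF V] subset_iff)
  qed
  have "trace_on V F = (\<Sum>b\<in>B. \<Sum>e\<in>E. ?rep (F e) b * fun_inner X b e)"
    by (simp add: trace_on_def Let_def rep mult.commute flip: B_def)
  also have "\<dots> = (\<Sum>e\<in>E. fun_inner X (\<lambda>x. \<Sum>b\<in>B. ?rep (F e) b * b x) e)"
    unfolding fun_inner_sum_left by (rule sum.swap)
  also have "\<dots> = (\<Sum>e\<in>E. fun_inner X (F e) e)"
  proof (rule sum.cong[OF refl])
    fix e assume "e \<in> E"
    then have "F e \<in> fvs.span B"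
      using B(2) F_closed EV by blast
    then have "F e = (\<Sum>b\<in>B. fscale (?rep (F e) b) b)"
      using fvs.sum_representation_eq[OF B(1) _ finB] by simp
    then have "F e = (\<lambda>x. \<Sum>b\<in>B. ?rep (F e) b * b x)"
      by (metis (no_types, lifting) ext fscale_def sum.cong sum_fun_apply)
    then show "fun_inner X (\<lambda>x. \<Sum>b\<in>B. ?rep (F e) b * b x) e = fun_inner X (F e) e"
      by simp
  qed
  finally show ?thesis .
qed

text \<open>The average of a unitary matrix representation is an orthogonal projection \<open>P\<close>, so its
  trace is the sum of the squared moduli of its entries; a nonzero fixed row vector forces \<open>P \<noteq> 0\<close>.\<close>

lemma average_trace_pos:
  fixes K :: "('a \<Rightarrow> 'a) \<Rightarrow> 'i \<Rightarrow> 'i \<Rightarrow> complex"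
  assumes S: "finite S" and I: "finite I"
    and mult: "\<And>p q x y. p permutes S \<Longrightarrow> q permutes S \<Longrightarrow> x \<in> I \<Longrightarrow> y \<in> I
      \<Longrightarrow> K (p \<circ> q) x y = (\<Sum>z\<in>I. K p x z * K q z y)"
    and adj: "\<And>p x y. p permutes S \<Longrightarrow> x \<in> I \<Longrightarrow> y \<in> I \<Longrightarrow> K (inv p) x y = cnj (K p y x)"
    and fixed: "\<And>p y. p permutes S \<Longrightarrow> y \<in> I \<Longrightarrow> (\<Sum>x\<in>I. \<theta> x * K p x y) = \<theta> y"
    and j: "j \<in> I" "\<theta> j \<noteq> 0"
  shows "0 < (\<Sum>p | p permutes S. \<Sum>x\<in>I. K p x x)"
proof -
  let ?G = "{p. p permutes S}"
  define N where "N = card ?G"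
  have finG: "finite ?G"
    using S by (simp add: finite_permutations)
  have "N > 0"
    unfolding N_def card_gt_0_iff using finG permutes_id[of S] by blast
  define T where "T = (\<lambda>x y. \<Sum>p\<in>?G. K p x y)"
  have T_adj: "T x y = cnj (T y x)" if "x \<in> I" "y \<in> I" for x y
    unfolding T_def by (subst sum_permutations_inverse) (simp add: adj that)
  have T_sq: "of_nat N * T x x = (\<Sum>y\<in>I. T x y * T y x)" if "x \<in> I" for x
  proof -
    have "(\<Sum>y\<in>I. T x y * T y x) = (\<Sum>y\<in>I. \<Sum>p\<in>?G. \<Sum>q\<in>?G. K p x y * K q y x)"
      by (simp add: T_def sum_product)
    also have "\<dots> = (\<Sum>p\<in>?G. \<Sum>q\<in>?G. \<Sum>y\<in>I. K p x y * K q y x)"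
      by (subst sum.swap, rule sum.cong[OF refl], rule sum.swap)
    also have "\<dots> = (\<Sum>p\<in>?G. \<Sum>q\<in>?G. K (p \<circ> q) x x)"
      by (intro sum.cong refl) (simp add: mult that)
    also have "\<dots> = (\<Sum>p\<in>?G. T x x)"
      unfolding T_def
      by (rule sum.cong[OF refl], rule setum_permutations_compose_left[symmetric]) simp
    finally show ?thesis
      by (simp add: N_def)
  qed
  have "of_nat N * (\<Sum>x\<in>I. T x x) = (\<Sum>x\<in>I. \<Sum>y\<in>I. T x y * cnj (T x y))"
    unfolding sum_distrib_left by (intro sum.cong refl) (simp add: T_sq flip: T_adj)
  then have eq: "of_nat N * (\<Sum>x\<in>I. T x x) = of_real (\<Sum>x\<in>I. \<Sum>y\<in>I. (cmod (T x y))\<^sup>2)"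
    by (simp add: complex_norm_square flip: of_real_power)
  have "(\<Sum>x\<in>I. \<theta> x * T x j) = of_nat N * \<theta> j"
  proof -
    have "(\<Sum>x\<in>I. \<theta> x * T x j) = (\<Sum>p\<in>?G. \<Sum>x\<in>I. \<theta> x * K p x j)"
      unfolding T_def sum_distrib_left by (rule sum.swap)
    also have "\<dots> = (\<Sum>p\<in>?G. \<theta> j)"
      by (intro sum.cong refl) (simp add: fixed j)
    finally show ?thesis
      by (simp add: N_def)
  qed
  then have "(\<Sum>x\<in>I. \<theta> x * T x j) \<noteq> 0"
    using \<open>N > 0\<close> j by simp
  then obtain x0 where x0: "x0 \<in> I" "T x0 j \<noteq> 0"
    by (metis (no_types, lifting) mult_zero_right sum.neutral)
  have "(\<Sum>x\<in>I. \<Sum>y\<in>I. (cmod (T x y))\<^sup>2) > 0"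
    using x0 j I by (intro sum_pos2[of _ x0] sum_pos2[of _ j] sum_nonneg) auto
  moreover have "(\<Sum>x\<in>I. T x x) = of_real ((\<Sum>x\<in>I. \<Sum>y\<in>I. (cmod (T x y))\<^sup>2) / real N)"
    using eq \<open>N > 0\<close> by (simp add: field_simps)
  ultimately have "0 < (\<Sum>x\<in>I. T x x)"
    using \<open>N > 0\<close> by (simp add: less_complex_def)
  then show ?thesis
    unfolding T_def by (subst sum.swap)
qed

section \<open>Invariant trilinear forms on tabloid modules\<close>

abbreviation relabel :: "(nat \<Rightarrow> nat) \<Rightarrow> nat set list \<Rightarrow> nat set list"
  where "relabel p \<equiv> map ((`) p)"

definition row_lists :: "nat \<Rightarrow> nat \<Rightarrow> nat set list set"
  where "row_lists n l = {T. set T \<subseteq> Pow {..<n} \<and> length T = l}"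

lemma finite_row_lists: "finite (row_lists n l)"
  unfolding row_lists_def by (rule finite_lists_length_eq) simp

lemma relabel_in_row_lists:
  assumes "p permutes {..<n}" "T \<in> row_lists n l"
  shows "relabel p T \<in> row_lists n l"
proof -
  have "p ` A \<subseteq> {..<n}" if "A \<in> set T" for A
    using that assms(2) permutes_image[OF assms(1)] unfolding row_lists_def by blast
  then show ?thesis
    using assms(2) by (simp add: row_lists_def image_subset_iff)
qed

lemma relabel_relabel: "relabel p (relabel q T) = relabel (p \<circ> q) T"
  by (simp add: image_comp)

lemma relabel_inv:
  assumes "p permutes S"
  shows "relabel p (relabel (inv p) T) = T" "relabel (inv p) (relabel p T) = T"
  unfolding relabel_relabel permutes_inv_o[OF assms] by (simp_all add: map_idI)

lemma sum_relabel:
  assumes "p permutes {..<n}"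
  shows "(\<Sum>T\<in>row_lists n l. f (relabel p T)) = (\<Sum>T\<in>row_lists n l. f T)"
  by (rule sum.reindex_bij_witness[where i = "relabel (inv p)" and j = "relabel p"])
    (use assms in \<open>simp_all add: relabel_inv relabel_in_row_lists permutes_inv del: map_map\<close>)

lemma perm_act_comp:
  assumes "p permutes S" "q permutes S"
  shows "perm_act (p \<circ> q) f = perm_act p (perm_act q f)"
proof -
  have "inv (p \<circ> q) = inv q \<circ> inv p"
    using assms by (simp add: o_inv_distrib permutes_bij)
  then show ?thesis
    unfolding perm_act_def relabel_relabel by simp
qed

lemma fun_inner_perm_act:
  assumes "p permutes {..<n}"
  shows "fun_inner (row_lists n l) (perm_act p f) (perm_act p g) = fun_inner (row_lists n l) f g"
  unfolding fun_inner_def perm_act_def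
  using sum_relabel[OF permutes_inv[OF assms], of "\<lambda>T. f T * cnj (g T)"] by simp

lemma perm_act_sum: "perm_act p (\<lambda>T. \<Sum>e\<in>E. c e * e T) = (\<lambda>T. \<Sum>e\<in>E. c e * perm_act p e T)"
  by (simp add: perm_act_def)

locale tabloid_module =
  fixes n l :: nat and V E :: "(nat set list \<Rightarrow> complex) set"
  assumes subspace: "fvs.subspace V"
    and supported: "\<And>v T. v \<in> V \<Longrightarrow> T \<notin> row_lists n l \<Longrightarrow> v T = 0"
    and closed: "\<And>p v. p permutes {..<n} \<Longrightarrow> v \<in> V \<Longrightarrow> perm_act p v \<in> V"
    and basis: "orthonormal_basis (row_lists n l) V E"
begin

abbreviation inn (infix \<open>\<bullet>\<close> 70) where "inn \<equiv> fun_inner (row_lists n l)"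

definition entry :: "(nat \<Rightarrow> nat) \<Rightarrow> (nat set list \<Rightarrow> complex) \<Rightarrow> (nat set list \<Rightarrow> complex) \<Rightarrow> complex"
  where "entry p a b = perm_act p b \<bullet> a"

lemma finite_basis: "finite E" and basis_in: "e \<in> E \<Longrightarrow> e \<in> V"
  and basis_expand: "v \<in> V \<Longrightarrow> v = (\<lambda>x. \<Sum>e\<in>E. (v \<bullet> e) * e x)"
  using basis unfolding orthonormal_basis_def by blast+

lemma perm_act_basis:
  assumes "p permutes {..<n}" "b \<in> E"
  shows "perm_act p b = (\<lambda>x. \<Sum>e\<in>E. entry p e b * e x)"
  unfolding entry_def by (rule basis_expand) (use assms closed basis_in in blast)

lemma entry_comp:
  assumes p: "p permutes {..<n}" and q: "q permutes {..<n}" and "b \<in> E"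
  shows "entry (p \<circ> q) a b = (\<Sum>c\<in>E. entry p a c * entry q c b)"
proof -
  have "perm_act (p \<circ> q) b = (\<lambda>x. \<Sum>c\<in>E. entry q c b * perm_act p c x)"
    unfolding perm_act_comp[OF p q] perm_act_basis[OF q \<open>b \<in> E\<close>] by (rule perm_act_sum)
  then show ?thesis
    unfolding entry_def[of _ a] by (simp only: fun_inner_sum_left) (simp add: mult.commute)
qed

lemma entry_inv:
  assumes p: "p permutes {..<n}"
  shows "entry (inv p) a b = cnj (entry p b a)"
proof -
  have "perm_act p (perm_act (inv p) b) = b"
    unfolding perm_act_comp[OF p permutes_inv[OF p], symmetric] permutes_inv_o[OF p]
    by (simp add: perm_act_def map_idI)
  then have "entry (inv p) a b = b \<bullet> perm_act p a"
    unfolding entry_def using fun_inner_perm_act[OF p, of l "perm_act (inv p) b" a] by simp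
  then show ?thesis
    by (simp add: entry_def cnj_fun_inner)
qed

lemma trace_perm_act:
  assumes "p permutes {..<n}"
  shows "trace_on V (perm_act p) = (\<Sum>e\<in>E. entry p e e)"
  unfolding entry_def
  by (rule trace_on_orthonormal_basis[OF finite_row_lists subspace _ basis])
    (use supported closed[OF assms] perm_act_sum in auto)

end

definition trilinear ::
  "('a \<Rightarrow> 'b \<Rightarrow> 'b \<Rightarrow> complex) \<Rightarrow> 'a set \<Rightarrow> 'b set \<Rightarrow> ('a \<Rightarrow> complex) \<Rightarrow> ('b \<Rightarrow> complex) \<Rightarrow> ('b \<Rightarrow> complex) \<Rightarrow> complex"
  where "trilinear \<kappa> X Y v w u = (\<Sum>(x, y, z)\<in>X \<times> Y \<times> Y. \<kappa> x y z * v x * cnj (w y) * cnj (u z))"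

lemma trilinear_sum1:
  "trilinear \<kappa> X Y (\<lambda>x. \<Sum>a\<in>E. \<alpha> a * a x) w u = (\<Sum>a\<in>E. \<alpha> a * trilinear \<kappa> X Y a w u)"
  unfolding trilinear_def sum_distrib_left sum_distrib_right case_prod_unfold
  by (subst sum.swap) (simp add: mult_ac)

lemma trilinear_sum2:
  "trilinear \<kappa> X Y v (\<lambda>x. \<Sum>a\<in>E. \<alpha> a * a x) u = (\<Sum>a\<in>E. cnj (\<alpha> a) * trilinear \<kappa> X Y v a u)"
  unfolding trilinear_def sum_distrib_left sum_distrib_right case_prod_unfold cnj_sum
  by (subst sum.swap) (simp add: mult_ac)

lemma trilinear_sum3:
  "trilinear \<kappa> X Y v w (\<lambda>x. \<Sum>a\<in>E. \<alpha> a * a x) = (\<Sum>a\<in>E. cnj (\<alpha> a) * trilinear \<kappa> X Y v w a)"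
  unfolding trilinear_def sum_distrib_left sum_distrib_right case_prod_unfold cnj_sum
  by (subst sum.swap) (simp add: mult_ac)

lemma trilinear_expand:
  "trilinear \<kappa> X Y (\<lambda>x. \<Sum>a\<in>E. \<alpha> a * a x) (\<lambda>x. \<Sum>b\<in>D. \<beta> b * b x) (\<lambda>x. \<Sum>c\<in>D. \<gamma> c * c x) =
    (\<Sum>(a, b, c)\<in>E \<times> D \<times> D. trilinear \<kappa> X Y a b c * (\<alpha> a * cnj (\<beta> b) * cnj (\<gamma> c)))"
  unfolding trilinear_sum1 trilinear_sum2 trilinear_sum3
  by (simp add: sum_distrib_left mult_ac flip: sum.cartesian_product)

lemma trilinear_perm_act:
  assumes p: "p permutes {..<n}"
    and \<kappa>: "\<And>x y z. x \<in> row_lists n l \<Longrightarrow> y \<in> row_lists n m \<Longrightarrow> z \<in> row_lists n m \<Longrightarrow>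
      \<kappa> (relabel p x) (relabel p y) (relabel p z) = \<kappa> x y z"
  shows "trilinear \<kappa> (row_lists n l) (row_lists n m) (perm_act p v) (perm_act p w) (perm_act p u) =
    trilinear \<kappa> (row_lists n l) (row_lists n m) v w u"
  unfolding trilinear_def
  by (rule sum.reindex_bij_witness[where j = "\<lambda>(x, y, z). (relabel (inv p) x, relabel (inv p) y, relabel (inv p) z)"
        and i = "\<lambda>(x, y, z). (relabel p x, relabel p y, relabel p z)"])
    (use p in \<open>auto simp: relabel_inv relabel_in_row_lists permutes_inv perm_act_def \<kappa>[symmetric] simp del: map_map\<close>)

lemma sum_triple_product:
  fixes f g h :: "_ \<Rightarrow> complex"
  shows "(\<Sum>(a, b, c)\<in>A \<times> B \<times> C. f a * g b * h c) = sum f A * sum g B * sum h C"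
proof -
  have "(\<Sum>(a, b, c)\<in>A \<times> B \<times> C. f a * g b * h c) = (\<Sum>a\<in>A. f a * (\<Sum>b\<in>B. g b * sum h C))"
    by (simp add: sum_distrib_left mult.assoc flip: sum.cartesian_product)
  then show ?thesis
    by (simp flip: sum_distrib_right)
qed

lemma average_character_product_pos:
  assumes V: "tabloid_module n l V E" and W: "tabloid_module n m W D"
    and \<kappa>: "\<And>p x y z. p permutes {..<n} \<Longrightarrow> x \<in> row_lists n l \<Longrightarrow> y \<in> row_lists n m \<Longrightarrow>
      z \<in> row_lists n m \<Longrightarrow> \<kappa> (relabel p x) (relabel p y) (relabel p z) = \<kappa> x y z"
    and nz: "v \<in> V" "w \<in> W" "u \<in> W" "trilinear \<kappa> (row_lists n l) (row_lists n m) v w u \<noteq> 0"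
  shows "0 < (\<Sum>p | p permutes {..<n}.
    trace_on V (perm_act p) * cnj (trace_on W (perm_act p) * trace_on W (perm_act p)))"
proof -
  interpret V: tabloid_module n l V E by fact
  interpret W: tabloid_module n m W D by fact
  let ?\<Theta> = "trilinear \<kappa> (row_lists n l) (row_lists n m)"
  let ?I = "E \<times> D \<times> D"
  define K where "K = (\<lambda>p (a, b, c) (a', b', c'). V.entry p a a' * cnj (W.entry p b b') * cnj (W.entry p c c'))"
  define \<theta> where "\<theta> = (\<lambda>(a, b, c). ?\<Theta> a b c)"
  have "?\<Theta> v w u = (\<Sum>(a, b, c)\<in>?I. \<theta> (a, b, c) * (V.inn v a * cnj (W.inn w b) * cnj (W.inn u c)))"
    by (subst V.basis_expand[OF nz(1)], subst W.basis_expand[OF nz(2)], subst W.basis_expand[OF nz(3)])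
      (simp add: trilinear_expand \<theta>_def)
  also have "\<dots> = 0" if "\<forall>y\<in>?I. \<theta> y = 0"
    using that by (intro sum.neutral) auto
  finally obtain y0 where y0: "y0 \<in> ?I" "\<theta> y0 \<noteq> 0"
    using nz(4) by blast
  have "0 < (\<Sum>p | p permutes {..<n}. \<Sum>x\<in>?I. K p x x)"
  proof (rule average_trace_pos[where K = K and \<theta> = \<theta> and j = y0])
    fix p q x y
    assume p: "p permutes {..<n}" and q: "q permutes {..<n}" and "x \<in> ?I" "y \<in> ?I"
    moreover obtain a b c a' b' c' where xy: "x = (a, b, c)" "y = (a', b', c')"
      by (metis surj_pair)
    ultimately have "K (p \<circ> q) x y = (\<Sum>(d, e, f)\<in>?I. (V.entry p a d * V.entry q d a')
        * cnj (W.entry p b e * W.entry q e b') * cnj (W.entry p c f * W.entry q f c'))"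
      unfolding sum_triple_product K_def xy case_prod_conv cnj_sum[symmetric]
      by (simp add: V.entry_comp W.entry_comp del: cnj_sum)
    also have "\<dots> = (\<Sum>z\<in>?I. K p x z * K q z y)"
      by (intro sum.cong refl) (auto simp: K_def xy mult_ac)
    finally show "K (p \<circ> q) x y = (\<Sum>z\<in>?I. K p x z * K q z y)" .
  next
    fix p x y
    assume "p permutes {..<n}"
    then show "K (inv p) x y = cnj (K p y x)"
      by (simp add: K_def V.entry_inv W.entry_inv case_prod_unfold)
  next
    fix p y
    assume p: "p permutes {..<n}" and y: "y \<in> ?I"
    then obtain a b c where abc: "y = (a, b, c)" "a \<in> E" "b \<in> D" "c \<in> D"
      by blast
    have "\<theta> y = ?\<Theta> (perm_act p a) (perm_act p b) (perm_act p c)"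
      using trilinear_perm_act[OF p, of l m \<kappa>] \<kappa>[OF p] by (simp add: \<theta>_def abc)
    also have "\<dots> = (\<Sum>x\<in>?I. \<theta> x * K p x y)"
      unfolding V.perm_act_basis[OF p abc(2)] W.perm_act_basis[OF p abc(3)] W.perm_act_basis[OF p abc(4)]
        trilinear_expand
      by (intro sum.cong refl) (auto simp: \<theta>_def K_def abc)
    finally show "(\<Sum>x\<in>?I. \<theta> x * K p x y) = \<theta> y" ..
  qed (use V.finite_basis W.finite_basis y0 in auto)
  moreover have "(\<Sum>x\<in>?I. K p x x) =
      trace_on V (perm_act p) * cnj (trace_on W (perm_act p) * trace_on W (perm_act p))"
    if "p permutes {..<n}" for p
    using sum_triple_product[of "\<lambda>a. V.entry p a a" "\<lambda>b. cnj (W.entry p b b)" "\<lambda>c. cnj (W.entry p c c)" E D D]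
    by (simp add: K_def V.trace_perm_act[OF that] W.trace_perm_act[OF that] case_prod_unfold mult.assoc)
  ultimately show ?thesis
    by simp
qed

section \<open>Tableaux and polytabloids\<close>

lemma permutes_conj:
  assumes "bij p" "q permutes A"
  shows "p \<circ> q \<circ> inv p permutes p ` A"
proof (rule bij_imp_permutes)
  have "bij_betw (inv p) (p ` A) A"
    using assms(1) by (simp add: bij_betw_def bij_is_inj inj_on_def image_comp image_inv_f_f)
  then show "bij_betw (p \<circ> q \<circ> inv p) (p ` A) (p ` A)"
    using permutes_imp_bij[OF assms(2)] bij_betw_subset[OF assms(1), of A "p ` A"]
    by (auto intro!: bij_betw_trans)
next
  fix x assume "x \<notin> p ` A"
  then have "inv p x \<notin> A"
    using assms(1) by (metis bij_inv_eq_iff image_eqI)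
  then show "(p \<circ> q \<circ> inv p) x = x"
    using permutes_not_in[OF assms(2)] assms(1) by (simp add: bij_is_surj surj_f_inv_f)
qed

lemma sign_conj:
  assumes "permutation p" "permutation q"
  shows "sign (p \<circ> q \<circ> inv p) = sign q"
  using assms by (simp add: sign_compose permutation_compose permutation_inverse sign_inverse mult.commute)

lemma conj_conj_inv:
  assumes "bij p"
  shows "inv p \<circ> (p \<circ> q \<circ> inv p) \<circ> p = q" "p \<circ> (inv p \<circ> q \<circ> p) \<circ> inv p = q"
  using assms by (auto simp: fun_eq_iff bij_is_inj bij_is_surj surj_f_inv_f)

lemma transpose_image_eq:
  assumes "x \<in> R \<longleftrightarrow> y \<in> R"
  shows "transpose x y ` R = R"
proof -
  have "transpose x y z \<in> R" if "z \<in> R" for z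
    using assms that by (metis transpose_apply_first transpose_apply_other transpose_apply_second)
  then have sub: "transpose x y ` R \<subseteq> R"
    by (rule image_subsetI)
  have "R = transpose x y ` transpose x y ` R"
    by (simp add: image_image)
  then show ?thesis
    using image_mono[OF sub, of "transpose x y"] sub by simp
qed

lemma finite_cells: "finite (cells lam)" and card_cells: "card (cells lam) = sum_list lam"
proof -
  have *: "cells lam = (SIGMA i:{..<length lam}. {..<lam ! i})"
    by (auto simp: cells_def)
  show "finite (cells lam)" "card (cells lam) = sum_list lam"
    unfolding * by (simp_all add: sum_list_sum_nth atLeast0LessThan)
qed

lemma tableaux_in: "t \<in> tableaux lam \<Longrightarrow> c \<in> cells lam \<Longrightarrow> t c < sum_list lam"
  unfolding tableaux_def by (auto dest: bij_betwE)

lemma tableaux_inj: "t \<in> tableaux lam \<Longrightarrow> c \<in> cells lam \<Longrightarrow> d \<in> cells lam \<Longrightarrow> t c = t d \<Longrightarrow> c = d"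
  unfolding tableaux_def bij_betw_def by (auto dest: inj_onD)

lemma tableaux_surj:
  assumes "t \<in> tableaux lam" "x < sum_list lam"
  obtains i j where "(i, j) \<in> cells lam" "x = t (i, j)"
  using assms unfolding tableaux_def bij_betw_def by (metis (mono_tags, lifting) image_iff lessThan_iff mem_Collect_eq surj_pair)

lemma comp_in_tableaux:
  "p permutes {..<sum_list lam} \<Longrightarrow> t \<in> tableaux lam \<Longrightarrow> p \<circ> t \<in> tableaux lam"
  unfolding tableaux_def using bij_betw_trans permutes_imp_bij by blast

lemma tabloid_comp: "tabloid lam (p \<circ> t) = relabel p (tabloid lam t)"
  by (auto simp: tabloid_def)

lemma length_tabloid: "length (tabloid lam t) = length lam"
  by (simp add: tabloid_def)

lemma nth_tabloid: "i < length lam \<Longrightarrow> tabloid lam t ! i = {t (i, j) | j. j < lam ! i}"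
  by (simp add: tabloid_def)

lemma tabloid_rows_disjoint:
  assumes "t \<in> tableaux lam" "i < length lam" "k < length lam"
    and "x \<in> tabloid lam t ! i" "x \<in> tabloid lam t ! k"
  shows "i = k"
proof -
  obtain j l where "j < lam ! i" "x = t (i, j)" "l < lam ! k" "x = t (k, l)"
    using assms by (auto simp: nth_tabloid)
  then show ?thesis
    using tableaux_inj[OF assms(1), of "(i, j)" "(k, l)"] assms(2,3) by (simp add: cells_def)
qed

lemma tabloid_in_row_lists:
  assumes "t \<in> tableaux lam"
  shows "tabloid lam t \<in> row_lists (sum_list lam) (length lam)"
  using tableaux_in[OF assms] by (auto simp: row_lists_def tabloid_def cells_def)

lemma column_comp: "column lam (p \<circ> t) j = p ` column lam t j"
  by (auto simp: column_def)

lemma column_row: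
  assumes "t \<in> tableaux lam" "(i, k) \<in> cells lam" "t (i, k) \<in> column lam t j"
  shows "k = j"
  using assms tableaux_inj[OF assms(1,2)] by (auto simp: column_def)

lemma finite_column_stabilizer: "finite (column_stabilizer lam t)"
  unfolding column_stabilizer_def by (rule finite_subset[OF _ finite_permutations[of "{..<sum_list lam}"]]) auto

lemma column_stabilizer_permutes: "q \<in> column_stabilizer lam t \<Longrightarrow> q permutes {..<sum_list lam}"
  and column_stabilizer_image: "q \<in> column_stabilizer lam t \<Longrightarrow> q ` column lam t j = column lam t j"
  by (auto simp: column_stabilizer_def)

lemma column_stabilizer_conj:
  assumes p: "p permutes {..<sum_list lam}" and q: "q \<in> column_stabilizer lam t"
  shows "p \<circ> q \<circ> inv p \<in> column_stabilizer lam (p \<circ> t)"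
proof -
  have "p \<circ> q \<circ> inv p permutes {..<sum_list lam}"
    using p column_stabilizer_permutes[OF q] by (intro permutes_compose permutes_inv)
  moreover have "(p \<circ> q \<circ> inv p) ` p ` column lam t j = p ` column lam t j" for j
  proof -
    have "(p \<circ> q \<circ> inv p) ` p ` column lam t j = p ` q ` column lam t j"
      using permutes_inverses(2)[OF p] by (simp add: image_image)
    then show ?thesis
      by (simp add: column_stabilizer_image[OF q])
  qed
  ultimately show ?thesis
    by (simp add: column_stabilizer_def column_comp)
qed

lemma permutes_column_imp_stabilizer:
  assumes t: "t \<in> tableaux lam" and A: "A \<subseteq> column lam t j" and q: "q permutes A"
  shows "q \<in> column_stabilizer lam t"
proof -
  have col: "column lam t k \<subseteq> {..<sum_list lam}" for k
    using tableaux_in[OF t] by (auto simp: column_def)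
  have "q ` column lam t k = column lam t k" for k
  proof (cases "k = j")
    case True
    then show ?thesis
      using permutes_image[OF permutes_subset[OF q A]] by simp
  next
    case False
    have "q x = x" if x: "x \<in> column lam t k" for x
    proof -
      obtain i where i: "(i, k) \<in> cells lam" "x = t (i, k)"
        using x by (auto simp: column_def)
      have "x \<notin> A"
        using A False column_row[OF t i(1), of j] i(2) by blast
      then show ?thesis
        by (rule permutes_not_in[OF q])
    qed
    then show ?thesis by simp
  qed
  moreover have "q permutes {..<sum_list lam}"
    using permutes_subset[OF q] A col by blast
  ultimately show ?thesis
    by (simp add: column_stabilizer_def)
qed

lemma cnj_polytabloid: "cnj (polytabloid lam t T) = polytabloid lam t T"
  by (auto simp: polytabloid_def intro!: sum.cong)

lemma sum_polytabloid:
  assumes "t \<in> tableaux lam"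
  shows "(\<Sum>T\<in>row_lists (sum_list lam) (length lam). polytabloid lam t T * f T) =
    (\<Sum>q\<in>column_stabilizer lam t. of_int (sign q) * f (tabloid lam (q \<circ> t)))"
proof -
  have "tabloid lam (q \<circ> t) \<in> row_lists (sum_list lam) (length lam)"
    if "q \<in> column_stabilizer lam t" for q
    using that assms by (intro tabloid_in_row_lists comp_in_tableaux column_stabilizer_permutes)
  then show ?thesis
    unfolding polytabloid_def sum_distrib_right
    by (subst sum.swap) (simp add: mult.assoc finite_row_lists if_distrib[of "\<lambda>x. x * _"] flip: sum_distrib_left cong: if_cong)
qed

lemma polytabloid_supported:
  assumes "t \<in> tableaux lam" "T \<notin> row_lists (sum_list lam) (length lam)"
  shows "polytabloid lam t T = 0"
  unfolding polytabloid_def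
  using assms tabloid_in_row_lists[OF comp_in_tableaux[OF column_stabilizer_permutes assms(1)]]
  by (intro sum.neutral) auto

lemma perm_act_polytabloid:
  assumes p: "p permutes {..<sum_list lam}"
  shows "perm_act p (polytabloid lam t) = polytabloid lam (p \<circ> t)"
proof
  fix T
  let ?f = "\<lambda>q. p \<circ> q \<circ> inv p" and ?g = "\<lambda>q. inv p \<circ> q \<circ> p"
  have bij: "bij p"
    using p by (rule permutes_bij)
  have "inv p \<circ> (p \<circ> t) = t"
    by (simp add: permutes_inv_o(2)[OF p] flip: comp_assoc)
  have perm: "permutation p"
    using p by (meson finite_lessThan permutation_permutes)
  have "(\<Sum>q\<in>column_stabilizer lam t. of_int (sign q) * (if tabloid lam (q \<circ> t) = relabel (inv p) T then 1 else 0)) =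
     (\<Sum>q\<in>column_stabilizer lam (p \<circ> t). of_int (sign q) * (if tabloid lam (q \<circ> (p \<circ> t)) = T then 1 else 0 :: complex))"
  proof (rule sum.reindex_bij_witness[where i = ?g and j = ?f])
    fix q assume q: "q \<in> column_stabilizer lam (p \<circ> t)"
    have "inv p \<circ> q \<circ> inv (inv p) \<in> column_stabilizer lam (inv p \<circ> (p \<circ> t))"
      using p q by (intro column_stabilizer_conj permutes_inv)
    then show "?g q \<in> column_stabilizer lam t"
      using bij by (simp add: inv_inv_eq \<open>inv p \<circ> (p \<circ> t) = t\<close>)
  next
    fix q assume q: "q \<in> column_stabilizer lam t"
    then show "?f q \<in> column_stabilizer lam (p \<circ> t)"
      by (rule column_stabilizer_conj[OF p])
    have "permutation q"
      using column_stabilizer_permutes[OF q] by (meson finite_lessThan permutation_permutes)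
    then have "sign (?f q) = sign q"
      using perm by (intro sign_conj)
    moreover have "?f q \<circ> (p \<circ> t) = p \<circ> (q \<circ> t)"
      using permutes_inverses[OF p] by (simp add: fun_eq_iff)
    then have "tabloid lam (?f q \<circ> (p \<circ> t)) = relabel p (tabloid lam (q \<circ> t))"
      by (simp only: tabloid_comp[of lam p])
    then have "tabloid lam (?f q \<circ> (p \<circ> t)) = T \<longleftrightarrow> tabloid lam (q \<circ> t) = relabel (inv p) T"
      using relabel_inv[OF p] by metis
    ultimately show "of_int (sign (?f q)) * (if tabloid lam (?f q \<circ> (p \<circ> t)) = T then 1 else 0 :: complex) =
        of_int (sign q) * (if tabloid lam (q \<circ> t) = relabel (inv p) T then 1 else 0)"
      by simp
  qed (use conj_conj_inv[OF bij] in auto)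
  then show "perm_act p (polytabloid lam t) T = polytabloid lam (p \<circ> t) T"
    by (simp add: perm_act_def polytabloid_def)
qed

lemma specht_tabloid_module:
  obtains E where "tabloid_module (sum_list lam) (length lam) (specht lam) E"
proof -
  let ?X = "row_lists (sum_list lam) (length lam)"
  have sub: "fvs.subspace (specht lam)"
    unfolding specht_def by (rule fvs.subspace_span)
  have supp: "v T = 0" if "v \<in> specht lam" "T \<notin> ?X" for v T
    using that(1) unfolding specht_def
  proof (induction rule: fvs.span_induct_alt)
    case (step c w v)
    then show ?case using polytabloid_supported that(2) by (auto simp: fscale_def)
  qed simp
  have closed: "perm_act p v \<in> specht lam" if p: "p permutes {..<sum_list lam}" and v: "v \<in> specht lam" for p v
    using v unfolding specht_def
  proof (induction rule: fvs.span_induct_alt)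
    case base
    have "perm_act p 0 = 0"
      by (simp add: perm_act_def fun_eq_iff)
    then show ?case
      using fvs.span_zero by metis
  next
    case (step c w v)
    then have "perm_act p w \<in> polytabloid lam ` tableaux lam"
      using perm_act_polytabloid[OF p] comp_in_tableaux[OF p] by auto
    moreover have "perm_act p (fscale c w + v) = fscale c (perm_act p w) + perm_act p v"
      by (simp add: perm_act_def fscale_def fun_eq_iff)
    ultimately show ?case
      using step by (metis fvs.span_add fvs.span_base fvs.span_scale)
  qed
  obtain E where "orthonormal_basis ?X (specht lam) E"
    using orthonormal_basis_exists[OF finite_row_lists sub] supp by blast
  then have "tabloid_module (sum_list lam) (length lam) (specht lam) E"
    using sub supp closed by unfold_locales auto
  then show thesis
    by (rule that)
qed

lemma polytabloid_column_stabilizer: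
  assumes t: "t \<in> tableaux lam" and s: "s \<in> column_stabilizer lam t"
  shows "polytabloid lam t (relabel s (tabloid lam t)) = of_int (sign s)"
proof -
  have "q = s" if q: "q \<in> column_stabilizer lam t" and eq: "tabloid lam (q \<circ> t) = tabloid lam (s \<circ> t)" for q
  proof
    fix x
    show "q x = s x"
    proof (cases "x < sum_list lam")
      case False
      then show ?thesis
        using column_stabilizer_permutes[OF q] column_stabilizer_permutes[OF s] by (simp add: permutes_not_in)
    next
      case True
      then obtain i j where ij: "(i, j) \<in> cells lam" "x = t (i, j)"
        using tableaux_surj[OF t] by blast
      then have i: "i < length lam" "j < lam ! i"
        by (auto simp: cells_def)
      have "q x \<in> tabloid lam (q \<circ> t) ! i"
        using i by (auto simp: nth_tabloid ij)
      then have "q x \<in> tabloid lam (s \<circ> t) ! i"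
        by (simp only: eq)
      then obtain k where k: "k < lam ! i" "q x = s (t (i, k))"
        using i by (auto simp: nth_tabloid)
      have "x \<in> column lam t j"
        using ij by (auto simp: column_def)
      then have "q x \<in> s ` column lam t j"
        unfolding column_stabilizer_image[OF s] using column_stabilizer_image[OF q] by blast
      then have "t (i, k) \<in> column lam t j"
        using k(2) permutes_inj[OF column_stabilizer_permutes[OF s]] by (simp add: inj_image_mem_iff)
      then have "k = j"
        using column_row[OF t, of i k j] i k by (simp add: cells_def)
      then show ?thesis
        using k ij by simp
    qed
  qed
  then have "polytabloid lam t (relabel s (tabloid lam t)) =
      (\<Sum>q\<in>column_stabilizer lam t. if q = s then of_int (sign s) else 0)"
    unfolding polytabloid_def tabloid_comp[symmetric] by (intro sum.cong) auto
  then show ?thesis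
    using s finite_column_stabilizer by simp
qed

lemma polytabloid_eq_0:
  assumes t: "t \<in> tableaux lam" and i: "i < length lam"
    and xy: "x \<in> T ! i" "y \<in> T ! i" "x \<in> column lam t j" "y \<in> column lam t j" "x \<noteq> y"
  shows "polytabloid lam t T = 0"
proof -
  have "tabloid lam (q \<circ> t) \<noteq> T" if q: "q \<in> column_stabilizer lam t" for q
  proof
    assume eq: "tabloid lam (q \<circ> t) = T"
    have "z = q (t (i, j))" if z: "z \<in> T ! i" "z \<in> column lam t j" for z
    proof -
      obtain k where k: "k < lam ! i" "z = q (t (i, k))"
        using z(1) i by (auto simp: nth_tabloid simp flip: eq)
      have "z \<in> q ` column lam t j"
        using z(2) by (simp add: column_stabilizer_image[OF q])
      then have "t (i, k) \<in> column lam t j"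
        using k(2) permutes_inj[OF column_stabilizer_permutes[OF q]] by (simp add: inj_image_mem_iff)
      then show ?thesis
        using column_row[OF t, of i k j] i k by (simp add: cells_def)
    qed
    then show False
      using xy by metis
  qed
  then show ?thesis
    by (simp add: polytabloid_def)
qed

section \<open>Antisymmetrizers\<close>

definition antisymmetrize :: "nat set \<Rightarrow> (nat set list \<Rightarrow> complex) \<Rightarrow> nat set list \<Rightarrow> complex"
  where "antisymmetrize A f S = (\<Sum>q | q permutes A. of_int (sign q) * f (relabel q S))"

definition antisym_kernel :: "nat set list \<Rightarrow> nat set list \<Rightarrow> nat set list \<Rightarrow> complex"
  where "antisym_kernel T S S' =
    (\<Sum>q | q permutes (T ! 1). of_int (sign q) * (if relabel q S' = S then 1 else 0))"

lemma row_lists_nth_subset: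
  assumes "T \<in> row_lists n l" "i < l"
  shows "T ! i \<subseteq> {..<n}"
proof -
  have "T ! i \<in> set T"
    using assms by (auto simp: row_lists_def)
  then show ?thesis
    using assms(1) unfolding row_lists_def by auto
qed

lemma antisym_kernel_relabel:
  assumes p: "p permutes {..<n}" and T: "T \<in> row_lists n 2"
  shows "antisym_kernel (relabel p T) (relabel p S) (relabel p S') = antisym_kernel T S S'"
proof -
  let ?f = "\<lambda>q. p \<circ> q \<circ> inv p" and ?g = "\<lambda>q. inv p \<circ> q \<circ> p"
  have bij: "bij p"
    using p by (rule permutes_bij)
  have perm: "permutation p"
    using p by (meson finite_lessThan permutation_permutes)
  have len: "length T = 2"
    using T by (simp add: row_lists_def)
  have "T ! 1 \<subseteq> {..<n}"
    using row_lists_nth_subset[OF T] by simp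
  then have fin: "finite (T ! 1)"
    by (rule finite_subset) simp
  show ?thesis
    unfolding antisym_kernel_def
  proof (rule sum.reindex_bij_witness[where i = ?f and j = ?g])
    fix q assume q: "q \<in> {q. q permutes (relabel p T ! 1)}"
    have "inv p \<circ> q \<circ> inv (inv p) permutes inv p ` p ` (T ! 1)"
      using q bij len by (intro permutes_conj bij_imp_bij_inv) auto
    then show g: "?g q \<in> {q. q permutes (T ! 1)}"
      using bij by (simp add: inv_inv_eq image_comp permutes_inv_o[OF p])
    have "sign q = sign (?f (?g q))"
      by (simp add: conj_conj_inv[OF bij])
    also have "\<dots> = sign (?g q)"
      using perm g fin by (intro sign_conj) (auto simp: permutation_permutes)
    finally have "sign (?g q) = sign q" ..
    moreover have "relabel q (relabel p S') = relabel p (relabel (?g q) S')"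
      unfolding relabel_relabel using permutes_inverses[OF p] by (intro arg_cong2[where f = map]) (auto simp: fun_eq_iff image_comp o_def)
    then have "relabel (?g q) S' = S \<longleftrightarrow> relabel q (relabel p S') = relabel p S"
      using relabel_inv(2)[OF p] by metis
    ultimately show "of_int (sign (?g q)) * (if relabel (?g q) S' = S then 1 else 0 :: complex) =
        of_int (sign q) * (if relabel q (relabel p S') = relabel p S then 1 else 0)"
      by simp
  next
    fix q assume "q \<in> {q. q permutes (T ! 1)}"
    then show "?f q \<in> {q. q permutes (relabel p T ! 1)}"
      using permutes_conj[OF bij] len by auto
  qed (use conj_conj_inv[OF bij] in auto)
qed

lemma sum_antisym_kernel:
  assumes "T ! 1 \<subseteq> {..<n}" "S' \<in> row_lists n m"
  shows "(\<Sum>S\<in>row_lists n m. antisym_kernel T S S' * f S) = antisymmetrize (T ! 1) f S'"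
proof -
  have "relabel q S' \<in> row_lists n m" if "q permutes (T ! 1)" for q
    using relabel_in_row_lists[OF permutes_subset[OF that assms(1)] assms(2)] .
  then show ?thesis
    unfolding antisym_kernel_def antisymmetrize_def sum_distrib_right
    by (subst sum.swap)
      (simp add: mult.assoc finite_row_lists if_distrib[of "\<lambda>x. x * _"] flip: sum_distrib_left cong: if_cong)
qed

lemma antisym_in_specht:
  assumes A: "A \<subseteq> {..<sum_list lam}" and f: "f \<in> specht lam"
  shows "antisymmetrize A f \<in> specht lam"
proof -
  obtain E where "tabloid_module (sum_list lam) (length lam) (specht lam) E"
    by (rule specht_tabloid_module)
  then interpret tabloid_module "sum_list lam" "length lam" "specht lam" E .
  have perm: "q permutes {..<sum_list lam}" if "q permutes A" for q
    using permutes_subset[OF that A] .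
  have "antisymmetrize A f = (\<Sum>q | q permutes A. fscale (of_int (sign q)) (perm_act (inv q) f))"
    using perm by (auto simp: antisymmetrize_def fun_eq_iff sum_fun_apply fscale_def perm_act_def permutes_inv_inv intro!: sum.cong)
  then show ?thesis
    using perm f by (auto intro!: fvs.subspace_sum[OF subspace] fvs.subspace_scale[OF subspace] closed permutes_inv)
qed

lemma antisym_eq_0:
  assumes "finite A" "x \<in> A" "y \<in> A" "x \<noteq> y" and S: "relabel (transpose x y) S = S"
  shows "antisymmetrize A f S = 0"
proof -
  let ?\<tau> = "transpose x y"
  have "antisymmetrize A f S = (\<Sum>q | q permutes A. of_int (sign (q \<circ> ?\<tau>)) * f (relabel (q \<circ> ?\<tau>) S))"
    unfolding antisymmetrize_def using assms by (intro sum_permutations_compose_right permutes_swap_id)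
  also have "\<dots> = (\<Sum>q | q permutes A. - (of_int (sign q) * f (relabel q S)))"
  proof (rule sum.cong[OF refl])
    fix q assume "q \<in> {q. q permutes A}"
    then have "permutation q"
      using assms(1) by (auto simp: permutation_permutes)
    then have "sign (q \<circ> ?\<tau>) = - sign q"
      using assms(4) by (simp add: sign_compose permutation_swap_id sign_swap_id)
    moreover have "relabel (q \<circ> ?\<tau>) S = relabel q S"
      by (simp only: S flip: relabel_relabel)
    then have "f (relabel (q \<circ> ?\<tau>) S) = f (relabel q S)"
      by (rule arg_cong)
    ultimately show "of_int (sign (q \<circ> ?\<tau>)) * f (relabel (q \<circ> ?\<tau>) S) = - (of_int (sign q) * f (relabel q S))"
      by simp
  qed
  also have "\<dots> = - antisymmetrize A f S"
    by (simp add: antisymmetrize_def sum_negf)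
  finally show ?thesis by simp
qed

lemma divide_of_real_pos: "0 < (z :: complex) \<Longrightarrow> 0 < r \<Longrightarrow> 0 < z / of_real r"
  by (simp add: less_complex_def Re_divide_of_real Im_divide_of_real)

lemma kronecker_two_row_pos:
  assumes len: "length lam = 2" and n: "sum_list lam = sum_list mu"
    and \<tau>: "\<tau> \<in> tableaux lam" and t: "t \<in> tableaux mu"
    and s: "s \<in> row_lists (sum_list mu) (length mu)"
    and nz: "(\<Sum>q\<in>column_stabilizer lam \<tau>. of_int (sign q) *
      antisymmetrize (tabloid lam (q \<circ> \<tau>) ! 1) (polytabloid mu t) s) \<noteq> 0"
  shows "0 < kronecker lam mu mu"
proof -
  let ?n = "sum_list mu"
  let ?X = "row_lists ?n 2" and ?Y = "row_lists ?n (length mu)"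
  let ?e = "polytabloid mu t"
  obtain E where E: "tabloid_module ?n 2 (specht lam) E"
    using specht_tabloid_module[of lam] len n by metis
  obtain D where D: "tabloid_module ?n (length mu) (specht mu) D"
    using specht_tabloid_module[of mu] by metis
  interpret W: tabloid_module ?n "length mu" "specht mu" D by fact
  define z where "z = (\<lambda>S. \<Sum>T\<in>?X. polytabloid lam \<tau> T * antisymmetrize (T ! 1) ?e S)"
  have row1: "T ! 1 \<subseteq> {..<?n}" if "T \<in> ?X" for T
    using row_lists_nth_subset[OF that] by simp
  have e: "?e \<in> specht mu"
    unfolding specht_def using t by (intro fvs.span_base) auto
  have v: "polytabloid lam \<tau> \<in> specht lam"
    unfolding specht_def using \<tau> by (intro fvs.span_base) auto
  have "z = (\<Sum>T\<in>?X. fscale (polytabloid lam \<tau> T) (antisymmetrize (T ! 1) ?e))"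
    by (simp add: z_def fun_eq_iff sum_fun_apply fscale_def)
  also have "\<dots> \<in> specht mu"
    using row1 by (intro fvs.subspace_sum fvs.subspace_scale W.subspace antisym_in_specht e)
  finally have z: "z \<in> specht mu" .
  have z_eq: "z S' = (\<Sum>T\<in>?X. \<Sum>S\<in>?Y. antisym_kernel T S S' * polytabloid lam \<tau> T * ?e S)"
    if "S' \<in> ?Y" for S'
    unfolding z_def
  proof (rule sum.cong[OF refl])
    fix T assume "T \<in> ?X"
    then show "polytabloid lam \<tau> T * antisymmetrize (T ! 1) ?e S' =
        (\<Sum>S\<in>?Y. antisym_kernel T S S' * polytabloid lam \<tau> T * ?e S)"
      by (subst sum_antisym_kernel[OF row1 that, symmetric]) (simp_all add: sum_distrib_left mult_ac)
  qed
  have "z s \<noteq> 0"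
    using nz sum_polytabloid[OF \<tau>, of "\<lambda>T. antisymmetrize (T ! 1) ?e s"] by (simp add: z_def len n)
  moreover have "trilinear antisym_kernel ?X ?Y (polytabloid lam \<tau>) ?e z = fun_inner ?Y z z"
  proof -
    have "trilinear antisym_kernel ?X ?Y (polytabloid lam \<tau>) ?e z =
        (\<Sum>T\<in>?X. \<Sum>S\<in>?Y. \<Sum>S'\<in>?Y. antisym_kernel T S S' * polytabloid lam \<tau> T * ?e S * cnj (z S'))"
      by (simp add: trilinear_def cnj_polytabloid flip: sum.cartesian_product)
    also have "\<dots> = (\<Sum>T\<in>?X. \<Sum>S'\<in>?Y. \<Sum>S\<in>?Y. antisym_kernel T S S' * polytabloid lam \<tau> T * ?e S * cnj (z S'))"
      by (rule sum.cong[OF refl], rule sum.swap)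
    also have "\<dots> = (\<Sum>S'\<in>?Y. \<Sum>T\<in>?X. \<Sum>S\<in>?Y. antisym_kernel T S S' * polytabloid lam \<tau> T * ?e S * cnj (z S'))"
      by (rule sum.swap)
    also have "\<dots> = fun_inner ?Y z z"
      unfolding fun_inner_def by (intro sum.cong refl) (simp add: z_eq sum_distrib_right)
    finally show ?thesis .
  qed
  ultimately have "trilinear antisym_kernel ?X ?Y (polytabloid lam \<tau>) ?e z \<noteq> 0"
    using s finite_row_lists
    by (auto simp: fun_inner_self sum_nonneg_eq_0_iff simp del: of_real_sum)
  then have "0 < (\<Sum>p | p permutes {..<?n}. trace_on (specht lam) (perm_act p)
      * cnj (trace_on (specht mu) (perm_act p) * trace_on (specht mu) (perm_act p)))"
    by (rule average_character_product_pos[OF E D _ v e z, rotated]) (rule antisym_kernel_relabel)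
  then have "0 < (\<Sum>p | p permutes {..<?n}. trace_on (specht lam) (perm_act p)
      * cnj (trace_on (specht mu) (perm_act p) * trace_on (specht mu) (perm_act p))) / of_real (fact ?n)"
    by (rule divide_of_real_pos) simp
  then show ?thesis
    by (simp only: kronecker_def char_inner_def irr_char_def n of_real_fact)
qed

section \<open>The two surviving terms\<close>

lemma bij_betw_extension:
  assumes "finite U" "finite W" "card U = card W" "D \<subseteq> U" "inj_on f D" "f ` D \<subseteq> W"
  obtains g where "bij_betw g U W" "\<And>x. x \<in> D \<Longrightarrow> g x = f x"
proof -
  have "card (U - D) = card (W - f ` D)"
    using assms by (simp add: card_Diff_subset card_image finite_subset)
  then obtain h where h: "bij_betw h (U - D) (W - f ` D)"
    using assms(1,2) finite_same_card_bij by blast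
  define g where "g = (\<lambda>x. if x \<in> D then f x else h x)"
  have "bij_betw g D (f ` D)"
    using assms(5) by (simp add: bij_betw_def g_def inj_on_def)
  moreover have "bij_betw g (U - D) (W - f ` D)"
    using h by (rule bij_betw_cong[THEN iffD1, rotated]) (simp add: g_def)
  ultimately have "bij_betw g (D \<union> (U - D)) (f ` D \<union> (W - f ` D))"
    by (rule bij_betw_combine) auto
  then have "bij_betw g U W"
    using assms(4,6) by (simp add: Un_absorb1)
  then show thesis
    using that by (simp add: g_def)
qed

locale hook_tableaux =
  fixes mu :: "nat list" and n p :: nat and t \<tau> :: "nat \<times> nat \<Rightarrow> nat"
  assumes n: "n = sum_list mu" and p2: "2 \<le> p" and pn: "p \<le> n - p"
    and leg: "p \<le> length mu" "\<And>i. i < p \<Longrightarrow> 0 < mu ! i" and arm: "p < mu ! 0"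
    and t: "t \<in> tableaux mu" and \<tau>: "\<tau> \<in> tableaux [n - p, p]"
    and \<tau>_row0: "\<And>j. j < p \<Longrightarrow> \<tau> (0, j) = t (0, Suc j)"
    and \<tau>_row1: "\<And>j. j < p \<Longrightarrow> \<tau> (1, j) = t (j, 0)"
begin

abbreviation lam where "lam \<equiv> [n - p, p]"
abbreviation a where "a j \<equiv> t (j, 0)"
abbreviation b where "b j \<equiv> t (0, Suc j)"

definition A where "A = a ` {..<p}"
definition swap where "swap = transpose (a 0) (b 0)"
definition s where "s = tabloid mu t"

lemma sum_lam: "sum_list lam = n"
  using p2 pn by simp

lemma lam_cells: "(i, j) \<in> cells lam \<longleftrightarrow> i = 0 \<and> j < n - p \<or> i = 1 \<and> j < p"
  by (auto simp: cells_def less_2_cases_iff nth_Cons')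

lemma mu_nonempty: "0 < length mu"
  using leg(1) p2 by linarith

lemma a_cell: "j < p \<Longrightarrow> (j, 0) \<in> cells mu" and b_cell: "j < p \<Longrightarrow> (0, Suc j) \<in> cells mu"
  using leg arm by (auto simp: cells_def)

lemma a_eq_iff: "i < p \<Longrightarrow> j < p \<Longrightarrow> a i = a j \<longleftrightarrow> i = j"
  and a_neq_b: "i < p \<Longrightarrow> j < p \<Longrightarrow> a i \<noteq> b j"
  using tableaux_inj[OF t a_cell a_cell] tableaux_inj[OF t a_cell b_cell] by blast+

lemma finite_A: "finite A" and card_A: "card A = p"
  using a_eq_iff by (auto simp: A_def card_image inj_on_def)

lemma A_column: "A \<subseteq> column mu t 0"
  using a_cell by (auto simp: A_def column_def)

lemma second_row: "tabloid lam (q \<circ> \<tau>) ! 1 = q ` A"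
proof -
  have "tabloid lam (q \<circ> \<tau>) ! 1 = (\<lambda>j. q (\<tau> (1, j))) ` {..<p}"
    by (auto simp: nth_tabloid)
  then show ?thesis
    unfolding A_def image_image using \<tau>_row1 by (auto intro!: image_cong)
qed

lemma b_row: "j < p \<Longrightarrow> b j \<in> s ! 0" and a0_row: "a 0 \<in> s ! 0"
  using mu_nonempty arm by (auto simp: s_def nth_tabloid)

lemma transpose_row:
  assumes "x \<in> s ! 0" "y \<in> s ! 0"
  shows "relabel (transpose x y) s = s"
proof (rule nth_equalityI)
  fix i assume "i < length (relabel (transpose x y) s)"
  then have i: "i < length mu"
    by (simp add: s_def length_tabloid)
  have "x \<notin> s ! i \<and> y \<notin> s ! i" if "i \<noteq> 0"
    using that assms tabloid_rows_disjoint[OF t i, of 0] leg p2 unfolding s_def by force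
  then have "x \<in> s ! i \<longleftrightarrow> y \<in> s ! i"
    using assms by (cases "i = 0") auto
  then show "relabel (transpose x y) s ! i = s ! i"
    using i transpose_image_eq by (simp add: s_def length_tabloid)
qed simp

lemma column_\<tau>: "j < p \<Longrightarrow> column lam \<tau> j = {a j, b j}"
  and column_\<tau>': "p \<le> j \<Longrightarrow> j < n - p \<Longrightarrow> column lam \<tau> j = {\<tau> (0, j)}"
proof -
  have "column lam \<tau> j = (if j < n - p then {\<tau> (0, j)} else {}) \<union> (if j < p then {\<tau> (1, j)} else {})" for j
    by (auto simp: column_def lam_cells)
  then show "j < p \<Longrightarrow> column lam \<tau> j = {a j, b j}" "p \<le> j \<Longrightarrow> j < n - p \<Longrightarrow> column lam \<tau> j = {\<tau> (0, j)}"
    using pn \<tau>_row0 \<tau>_row1 by auto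
qed

lemma \<tau>_entries:
  assumes "x < n"
  obtains j where "j < p" "x = a j" | j where "j < p" "x = b j" | j where "p \<le> j" "j < n - p" "x = \<tau> (0, j)"
proof -
  obtain i j where ij: "(i, j) \<in> cells lam" "x = \<tau> (i, j)"
    using tableaux_surj[OF \<tau>] assms sum_lam by metis
  then have "i = 0 \<and> j < n - p \<or> i = 1 \<and> j < p"
    by (simp add: lam_cells)
  then show thesis
    using that ij \<tau>_row0 \<tau>_row1 by (metis not_le)
qed

lemma swap_in: "swap \<in> column_stabilizer lam \<tau>"
proof (rule permutes_column_imp_stabilizer[OF \<tau>, of _ 0])
  show "{a 0, b 0} \<subseteq> column lam \<tau> 0"
    using column_\<tau>[of 0] p2 by simp
qed (simp add: swap_def permutes_swap_id)

lemma stabilizer_cases: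
  assumes q: "q \<in> column_stabilizer lam \<tau>" "q \<noteq> id" "q \<noteq> swap"
  obtains x y where "x \<in> q ` A" "y \<in> q ` A" "x \<noteq> y" "x \<in> s ! 0" "y \<in> s ! 0"
proof -
  have perm: "q permutes {..<n}"
    using column_stabilizer_permutes[OF q(1)] sum_lam by simp
  have pair: "q (a j) = a j \<and> q (b j) = b j \<or> q (a j) = b j \<and> q (b j) = a j" if "j < p" for j
  proof -
    have "q ` {a j, b j} = {a j, b j}"
      using column_stabilizer_image[OF q(1), of j] column_\<tau>[OF that] by simp
    moreover have "q (a j) \<noteq> q (b j)"
      using inj_eq[OF permutes_inj[OF perm]] a_neq_b[OF that that] by simp
    ultimately show ?thesis
      by (auto simp: doubleton_eq_iff)
  qed
  have rest: "q (\<tau> (0, j)) = \<tau> (0, j)" if "p \<le> j" "j < n - p" for j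
    using column_stabilizer_image[OF q(1), of j] column_\<tau>'[OF that] by simp
  show thesis
  proof (cases "\<exists>j<p. j \<noteq> 0 \<and> q (a j) = b j")
    case True
    then obtain j where j: "j < p" "j \<noteq> 0" "q (a j) = b j"
      by blast
    show thesis
    proof (rule that)
      show "q (a 0) \<in> q ` A" "b j \<in> q ` A"
        using j p2 by (auto simp: A_def image_image intro!: image_eqI[of _ _ j])
      show "q (a 0) \<noteq> b j"
        using inj_eq[OF permutes_inj[OF perm], of "a 0" "a j"] a_eq_iff[of 0 j] j p2 by auto
      show "q (a 0) \<in> s ! 0" "b j \<in> s ! 0"
        using pair[of 0] p2 b_row a0_row j by auto
    qed
  next
    case False
    then have fixed: "q (a j) = a j" "q (b j) = b j" if "j < p" "j \<noteq> 0" for j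
      using pair[OF that(1)] that by auto
    have "q = id \<or> q = swap"
    proof (cases "q (a 0) = a 0")
      case True
      then have "q (b 0) = b 0"
        using pair[of 0] p2 a_neq_b[of 0 0] by auto
      have "q x = x" for x
      proof (cases "x < n")
        case True
        then show ?thesis
          using fixed rest \<open>q (a 0) = a 0\<close> \<open>q (b 0) = b 0\<close> by (elim \<tau>_entries) metis+
      qed (simp add: permutes_not_in[OF perm])
      then show ?thesis by auto
    next
      case False
      then have q0: "q (a 0) = b 0" "q (b 0) = a 0"
        using pair[of 0] p2 by auto
      have "q x = swap x" for x
      proof (cases "x = a 0 \<or> x = b 0")
        case True
        then show ?thesis
          using q0 by (auto simp: swap_def)
      next
        case False
        have "q x = x"
        proof (cases "x < n")
          case True
          then show ?thesis
            using fixed rest False by (elim \<tau>_entries) metis+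
        qed (simp add: permutes_not_in[OF perm])
        then show ?thesis
          using False by (simp add: swap_def transpose_def)
      qed
      then show ?thesis by auto
    qed
    then show thesis
      using q by blast
  qed
qed

lemma antisym_A: "antisymmetrize A (polytabloid mu t) s = fact p"
proof -
  have "of_int (sign q) * polytabloid mu t (relabel q s) = 1" if "q permutes A" for q
    using polytabloid_column_stabilizer[OF t permutes_column_imp_stabilizer[OF t A_column that]]
    by (simp add: s_def flip: of_int_mult)
  then show ?thesis
    using card_permutations[OF card_A finite_A] by (simp add: antisymmetrize_def)
qed

lemma antisym_swap_A: "antisymmetrize (swap ` A) (polytabloid mu t) s = fact (p - 1)"
proof -
  define A0 where "A0 = a ` {1..<p}"
  have A0: "A0 \<subseteq> A" "finite A0" "card A0 = p - 1"
    using a_eq_iff by (auto simp: A0_def A_def card_image inj_on_def)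
  have "b 0 \<noteq> a j \<and> a 0 \<noteq> a j" if "j \<in> {1..<p}" for j
    using that a_neq_b[of j 0] a_eq_iff[of 0 j] p2 by auto
  then have b0: "b 0 \<notin> A0" and a0: "a 0 \<notin> A0"
    unfolding A0_def by blast+
  have "A = insert (a 0) A0"
    using p2 by (auto simp: A_def A0_def image_iff) (metis One_nat_def atLeastLessThan_iff less_one not_less)
  moreover have "swap ` A0 = A0"
    unfolding swap_def using a0 b0 by (intro transpose_image_eq) simp
  ultimately have swap_A: "swap ` A = insert (b 0) A0"
    by (simp add: swap_def)
  let ?f = "\<lambda>q. of_int (sign q) * polytabloid mu t (relabel q s)"
  have "antisymmetrize (swap ` A) (polytabloid mu t) s = (\<Sum>q | q permutes A0. ?f q)"
    unfolding antisymmetrize_def swap_A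
  proof (rule sum.mono_neutral_right)
    show "{q. q permutes A0} \<subseteq> {q. q permutes insert (b 0) A0}"
      by (auto intro: permutes_subset)
    show "\<forall>q\<in>{q. q permutes insert (b 0) A0} - {q. q permutes A0}. ?f q = 0"
    proof
      fix q assume "q \<in> {q. q permutes insert (b 0) A0} - {q. q permutes A0}"
      then have q: "q permutes insert (b 0) A0" "\<not> q permutes A0"
        by auto
      have "q (b 0) \<noteq> b 0"
        using q permutes_superset[OF q(1), of A0] by auto
      then have qb: "q (b 0) \<in> A0"
        using permutes_in_image[OF q(1), of "b 0"] by auto
      have qa: "q (a 0) = a 0"
        using permutes_not_in[OF q(1), of "a 0"] a0 a_neq_b[of 0 0] p2 by auto
      have "polytabloid mu t (relabel q s) = 0"
      proof (rule polytabloid_eq_0[OF t, of 0 "a 0" _ "q (b 0)" 0])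
        show "0 < length mu"
          by (rule mu_nonempty)
        then have row: "relabel q s ! 0 = q ` (s ! 0)"
          by (simp add: s_def length_tabloid)
        show "a 0 \<in> relabel q s ! 0" "q (b 0) \<in> relabel q s ! 0"
          unfolding row using a0_row b_row[of 0] p2 qa by (force, simp)
        show "a 0 \<in> column mu t 0" "q (b 0) \<in> column mu t 0"
          using A_column A0(1) qb p2 by (auto simp: A_def)
        show "a 0 \<noteq> q (b 0)"
          using a0 qb by metis
      qed
      then show "?f q = 0" by simp
    qed
  qed (use A0 in \<open>simp add: finite_permutations\<close>)
  also have "\<dots> = (\<Sum>q | q permutes A0. 1)"
  proof (rule sum.cong[OF refl])
    fix q assume "q \<in> {q. q permutes A0}"
    then have "q \<in> column_stabilizer mu t"
      using permutes_column_imp_stabilizer[OF t, of A0 0 q] A0(1) A_column by auto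
    then show "?f q = 1"
      using polytabloid_column_stabilizer[OF t] by (simp add: s_def flip: of_int_mult)
  qed
  also have "\<dots> = fact (p - 1)"
    using card_permutations[OF A0(3,2)] by simp
  finally show ?thesis .
qed

lemma alternating_sum:
  "(\<Sum>q\<in>column_stabilizer lam \<tau>. of_int (sign q) * antisymmetrize (tabloid lam (q \<circ> \<tau>) ! 1) (polytabloid mu t) s)
    = fact p - fact (p - 1)"
proof -
  let ?f = "\<lambda>q. of_int (sign q) * antisymmetrize (q ` A) (polytabloid mu t) s"
  have "swap \<noteq> id"
    using a_neq_b[of 0 0] p2 by (auto simp: swap_def fun_eq_iff transpose_def)
  have "id \<in> column_stabilizer lam \<tau>"
    by (simp add: column_stabilizer_def)
  then have "(\<Sum>q\<in>column_stabilizer lam \<tau>. ?f q) = (\<Sum>q\<in>{id, swap}. ?f q)"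
  proof (intro sum.mono_neutral_right finite_column_stabilizer ballI)
    fix q assume q: "q \<in> column_stabilizer lam \<tau> - {id, swap}"
    then obtain x y where "x \<in> q ` A" "y \<in> q ` A" "x \<noteq> y" "x \<in> s ! 0" "y \<in> s ! 0"
      using stabilizer_cases[of q] by blast
    then show "?f q = 0"
      using antisym_eq_0[of "q ` A" x y s] transpose_row finite_A by simp
  qed (use swap_in in auto)
  also have "\<dots> = fact p - fact (p - 1)"
    using \<open>swap \<noteq> id\<close> a_neq_b[of 0 0] p2
    by (simp add: antisym_A antisym_swap_A) (simp add: swap_def sign_swap_id)
  finally show ?thesis
    by (simp only: second_row)
qed

end

theorem theorem4p11:
  fixes mu :: "nat list" and n p :: nat
  assumes "mu \<turnstile> n"
    and "2 \<le> p"
    and "real p \<le> min (real (length mu)) ((1 + real (largest_part mu)) / 2)"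
  shows "[n - p, p] \<in> Phi mu"
proof -
  have len: "p \<le> length mu"
    using assms(3) by simp
  then have "mu \<noteq> []"
    using assms(2) by auto
  then have "real p \<le> (1 + real (mu ! 0)) / 2"
    using assms(3) by (simp add: largest_part_def hd_conv_nth)
  then have arm: "p < mu ! 0"
    using assms(2) by simp
  have n: "n = sum_list mu"
    using assms(1) by (simp add: is_partition_def)
  have leg: "0 < mu ! i" if "i < p" for i
    using assms(1) len that by (simp add: is_partition_def)
  obtain t where t: "bij_betw t (cells mu) {..<n}"
    using finite_same_card_bij[OF finite_cells, of "{..<n}" mu] by (auto simp: card_cells n)
  then have t_tab: "t \<in> tableaux mu"
    by (simp add: tableaux_def n)
  define f where "f = (\<lambda>(i, j). if i = (0 :: nat) then t (0, Suc j) else t (j, 0))"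
  define D where "D = {0, 1 :: nat} \<times> {..<p}"
  define c where "c = (\<lambda>(i, j). if i = (0 :: nat) then (0 :: nat, Suc j) else (j, 0))"
  have f_c: "f = t \<circ> c"
    by (auto simp: f_def c_def fun_eq_iff)
  have "c ` D \<subseteq> cells mu"
    using len arm leg by (auto simp: c_def D_def cells_def)
  moreover have "inj_on c D"
    by (auto simp: c_def D_def inj_on_def)
  ultimately have f: "inj_on f D" "f ` D \<subseteq> {..<n}"
    unfolding f_c using t by (auto simp: bij_betw_def intro: comp_inj_on inj_on_subset)
  then have "card D \<le> n"
    using card_inj_on_le[of f D "{..<n}"] by simp
  then have pn: "p \<le> n - p"
    by (simp add: D_def card_cartesian_product)
  have "card (cells [n - p, p]) = card {..<n}"
    using pn by (simp add: card_cells)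
  moreover have "D \<subseteq> cells [n - p, p]"
    using pn by (auto simp: D_def cells_def)
  ultimately obtain \<tau> where \<tau>: "bij_betw \<tau> (cells [n - p, p]) {..<n}" "\<And>x. x \<in> D \<Longrightarrow> \<tau> x = f x"
    using bij_betw_extension[OF finite_cells finite_lessThan _ _ f] by metis
  interpret hook_tableaux mu n p t \<tau>
    using n assms(2) pn len leg arm t_tab \<tau> by unfold_locales (auto simp: tableaux_def D_def f_def)
  have "fact (p - 1) < (fact p :: nat)"
    using assms(2) by (intro fact_less_mono_nat) auto
  then have "(fact p :: complex) \<noteq> fact (p - 1)"
    by (metis nat_neq_iff of_nat_eq_iff of_nat_fact)
  then have "0 < kronecker [n - p, p] mu mu"
    using \<tau> t_tab alternating_sum sum_lam n tabloid_in_row_lists[OF t_tab]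
    by (intro kronecker_two_row_pos[where \<tau> = \<tau> and t = t and s = s]) (auto simp: tableaux_def s_def)
  moreover have "[n - p, p] \<turnstile> sum_list mu"
    using pn assms(2) n by (simp add: is_partition_def)
  ultimately show ?thesis
    by (simp add: Phi_def)
qed

end
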